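(* Consider the standard action of Thompson's group $F$ on $[0,1]$. Suppose we are given two pairwise disjoint open dyadic subintervals $I_i=(p_i,q_i)\subseteq[0,1]$, $i=1,2$, and assume that $p_1<p_2$. Fix any non-trivial $h_1\in F_{\bar I_1}$ and $h_2\in F_{\bar I_2}$ and denote $$w^-=[h_1^{y},h_2]=y^{-1}h_1^{-1}yh_2^{-1}y^{-1}h_1yh_2,$$ $$w^+=[h_1^{(y^{-1})},h_2]=yh_1^{-1}y^{-1}h_2^{-1}yh_1y^{-1}h_2.$$ Then the word $w:=[w^-,w^+]$ is a law with constants in $F$.
   Context: Thompson's group $F$ is the group, under composition, of all strictly increasing continuous piecewise-linear functions from $[0,1]$ onto itself which are differentiable except at finitely many dyadic rationals and all of whose slopes are integer powers of $2$; it acts on $[0,1]$ on the left. A dyadic interval is a non-degenerate interval whose endpoints are dyadic rationals. For a dyadic interval $[a,b]\subseteq[0,1]$, $F_{[a,b]}$ is the subgroup of elements of $F$ which are trivial on the complement of $[a,b]$; $\bar I$ denotes the closure of $I$. Conventions: $h^y=y^{-1}hy$ and $[a,b]=a^{-1}b^{-1}ab$. Here $y$ is a variable, i.e. a generator of $\mathbb{Z}$ in $\mathbb{Z}\ast F$. A law with constants in a group $G$ is a non-trivial word $w(y_1,\ldots,y_t)$ over $G$, reduced in $\mathbb{F}_t\ast G$ ($\mathbb{F}_t$ free on $y_1,\ldots,y_t$), containing at least one variable and at least one constant, such that $w(\bar g)=1$ for every $\bar g\in G^t$. (An unreduced word is identified with its reduced form.) *)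

theory Defs
  imports Complex_Main "HOL-Algebra.Bij"
begin

section \<open>Thompson's group F\<close>

definition dyadic :: "real \<Rightarrow> bool" where
  "dyadic x \<longleftrightarrow> (\<exists>(k::int) (n::nat). x = of_int k / 2 ^ n)"

definition piecewise_linear :: "real \<Rightarrow> real \<Rightarrow> (real \<Rightarrow> real) \<Rightarrow> bool" where
  "piecewise_linear l r f \<longleftrightarrow>
     (\<exists>S. finite S \<and>
       (\<forall>a b. l \<le> a \<and> a < b \<and> b \<le> r \<and> {a<..<b} \<inter> S = {} \<longrightarrow>
         (\<exists>m c. \<forall>x\<in>{a..b}. f x = m * x + c)))"

text \<open>Derivatives are taken within \<open>{0..1}\<close>, so at the end points they are one-sided.
  As in \<^const>\<open>BijGroup\<close>, maps of \<open>[0,1]\<close> are represented by functions that are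
  \<^const>\<open>undefined\<close> elsewhere.\<close>

definition thompson_maps :: "(real \<Rightarrow> real) set" where
  "thompson_maps = {f \<in> extensional {0..1}.
     strict_mono_on {0..1} f \<and> continuous_on {0..1} f \<and> f ` {0..1} = {0..1} \<and>
     piecewise_linear 0 1 f \<and>
     (\<exists>S. finite S \<and> (\<forall>x\<in>S. dyadic x) \<and>
        (\<forall>x\<in>{0..1} - S. f differentiable (at x within {0..1}))) \<and>
     (\<forall>x\<in>{0..1}. \<forall>m. (f has_real_derivative m) (at x within {0..1}) \<longrightarrow>
        (\<exists>k::int. m = 2 powi k))}"

text \<open>Multiplication in \<^const>\<open>BijGroup\<close> is composition, \<open>(f \<otimes> g) x = f (g x)\<close>, so that
  the group acts on the left.\<close>

definition thompson_F :: "(real \<Rightarrow> real) monoid" where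
  "thompson_F = (BijGroup {0..1}) \<lparr>carrier := thompson_maps\<rparr>"

definition thompson_F_on :: "real \<Rightarrow> real \<Rightarrow> (real \<Rightarrow> real) set" where
  "thompson_F_on a b = {f \<in> carrier thompson_F. \<forall>x\<in>{0..1} - {a..b}. f x = x}"


section \<open>Words with constants\<close>

text \<open>A word over \<open>G\<close> in the variables \<open>y\<^sub>0, y\<^sub>1, \<dots>\<close>: \<open>Var i\<close> stands for the generator
  \<open>y\<^sub>i\<close> and \<open>VarInv i\<close> for its inverse. Elements of the free product of the free group on
  \<open>y\<^sub>0, \<dots>, y\<^sub>t\<^sub>-\<^sub>1\<close> with \<open>G\<close> are represented by the reduced words.\<close>

datatype 'g letter = Var nat | VarInv nat | Const 'g

type_synonym 'g word = "'g letter list"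

fun letter_in :: "('g, 'm) monoid_scheme \<Rightarrow> nat \<Rightarrow> 'g letter \<Rightarrow> bool" where
  "letter_in G t (Var i) \<longleftrightarrow> i < t"
| "letter_in G t (VarInv i) \<longleftrightarrow> i < t"
| "letter_in G t (Const g) \<longleftrightarrow> g \<in> carrier G"

fun letter_inv :: "('g, 'm) monoid_scheme \<Rightarrow> 'g letter \<Rightarrow> 'g letter" where
  "letter_inv G (Var i) = VarInv i"
| "letter_inv G (VarInv i) = Var i"
| "letter_inv G (Const g) = Const (inv\<^bsub>G\<^esub> g)"

definition word_inv :: "('g, 'm) monoid_scheme \<Rightarrow> 'g word \<Rightarrow> 'g word" where
  "word_inv G w = rev (map (letter_inv G) w)"

definition word_conj :: "('g, 'm) monoid_scheme \<Rightarrow> 'g word \<Rightarrow> 'g word \<Rightarrow> 'g word" where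
  "word_conj G u v = word_inv G v @ u @ v"

definition word_comm :: "('g, 'm) monoid_scheme \<Rightarrow> 'g word \<Rightarrow> 'g word \<Rightarrow> 'g word" where
  "word_comm G u v = word_inv G u @ word_inv G v @ u @ v"

fun reducible_pair :: "'g letter \<Rightarrow> 'g letter \<Rightarrow> bool" where
  "reducible_pair (Var i) (VarInv j) \<longleftrightarrow> i = j"
| "reducible_pair (VarInv i) (Var j) \<longleftrightarrow> i = j"
| "reducible_pair (Const g) (Const h) \<longleftrightarrow> True"
| "reducible_pair _ _ \<longleftrightarrow> False"

definition reduced_word :: "('g, 'm) monoid_scheme \<Rightarrow> 'g word \<Rightarrow> bool" where
  "reduced_word G w \<longleftrightarrow>
     Const \<one>\<^bsub>G\<^esub> \<notin> set w \<and> successively (\<lambda>a b. \<not> reducible_pair a b) w"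

text \<open>Multiplies a reduced word from the left by one letter.\<close>

fun letter_mult :: "('g, 'm) monoid_scheme \<Rightarrow> 'g letter \<Rightarrow> 'g word \<Rightarrow> 'g word" where
  "letter_mult G (Var i) (VarInv j # w) = (if i = j then w else Var i # VarInv j # w)"
| "letter_mult G (VarInv i) (Var j # w) = (if i = j then w else VarInv i # Var j # w)"
| "letter_mult G (Const g) (Const h # w) =
     (if g \<otimes>\<^bsub>G\<^esub> h = \<one>\<^bsub>G\<^esub> then w else Const (g \<otimes>\<^bsub>G\<^esub> h) # w)"
| "letter_mult G (Const g) w = (if g = \<one>\<^bsub>G\<^esub> then w else Const g # w)"
| "letter_mult G a w = a # w"

definition reduced_form :: "('g, 'm) monoid_scheme \<Rightarrow> 'g word \<Rightarrow> 'g word" where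
  "reduced_form G w = foldr (letter_mult G) w []"

fun letter_eval :: "('g, 'm) monoid_scheme \<Rightarrow> (nat \<Rightarrow> 'g) \<Rightarrow> 'g letter \<Rightarrow> 'g" where
  "letter_eval G v (Var i) = v i"
| "letter_eval G v (VarInv i) = inv\<^bsub>G\<^esub> (v i)"
| "letter_eval G v (Const g) = g"

definition word_eval :: "('g, 'm) monoid_scheme \<Rightarrow> (nat \<Rightarrow> 'g) \<Rightarrow> 'g word \<Rightarrow> 'g" where
  "word_eval G v w = foldr (\<lambda>a x. letter_eval G v a \<otimes>\<^bsub>G\<^esub> x) w \<one>\<^bsub>G\<^esub>"

definition law_with_constants :: "('g, 'm) monoid_scheme \<Rightarrow> nat \<Rightarrow> 'g word \<Rightarrow> bool" where
  "law_with_constants G t w \<longleftrightarrow>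
     (\<forall>a\<in>set w. letter_in G t a) \<and> reduced_word G w \<and> w \<noteq> [] \<and>
     (\<exists>i. Var i \<in> set w \<or> VarInv i \<in> set w) \<and> (\<exists>g. Const g \<in> set w) \<and>
     (\<forall>v \<in> {..<t} \<rightarrow> carrier G. word_eval G v w = \<one>\<^bsub>G\<^esub>)"


subsection \<open>Correctness of the reduced form\<close>

lemma reduced_form_in_and_reduced:
  assumes "group G" "\<forall>a\<in>set w. letter_in G t a"
  shows "(\<forall>a\<in>set (reduced_form G w). letter_in G t a) \<and> reduced_word G (reduced_form G w)"
proof -
  interpret group G by fact
  have step: "(\<forall>b\<in>set (letter_mult G a u). letter_in G t b) \<and> reduced_word G (letter_mult G a u)"
    if "letter_in G t a" "\<forall>b\<in>set u. letter_in G t b" "reduced_word G u" for a u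
  proof (cases u)
    case Nil
    then show ?thesis using that by (cases a) (auto simp: reduced_word_def)
  next
    case (Cons b u')
    show ?thesis
    proof (cases u')
      case Nil
      then show ?thesis using that Cons by (cases a; cases b) (auto simp: reduced_word_def)
    next
      case (Cons c u'')
      then show ?thesis using that \<open>u = b # u'\<close>
        by (cases a; cases b; cases c) (auto simp: reduced_word_def)
    qed
  qed
  show ?thesis
    using assms(2)
    by (induction w) (use step in \<open>auto simp: reduced_form_def reduced_word_def\<close>)
qed

lemma reduced_form_id:
  assumes "reduced_word G w"
  shows "reduced_form G w = w"
  using assms
proof (induction w)
  case (Cons a w)
  then have "reduced_form G w = w"
    by (auto simp: reduced_word_def successively_Cons)
  moreover have "letter_mult G a w = a # w"
  proof (cases w)
    case Nil
    then show ?thesis using Cons.prems by (cases a) (auto simp: reduced_word_def)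
  next
    case (Cons b w')
    then show ?thesis using \<open>reduced_word G (a # w)\<close>
      by (cases a; cases b) (auto simp: reduced_word_def)
  qed
  ultimately show ?case by (simp add: reduced_form_def)
qed (simp add: reduced_form_def)

lemma word_eval_reduced_form:
  assumes "group G" "\<forall>a\<in>set w. letter_in G t a" "v \<in> {..<t} \<rightarrow> carrier G"
  shows "word_eval G v (reduced_form G w) = word_eval G v w"
proof -
  interpret group G by fact
  have cl: "letter_eval G v a \<in> carrier G" if "letter_in G t a" for a
    using that assms(3) by (cases a) auto
  have wcl: "word_eval G v u \<in> carrier G" if "\<forall>b\<in>set u. letter_in G t b" for u
    using that by (induction u) (auto simp: word_eval_def cl)
  have vcl: "v i \<in> carrier G" if "i < t" for i using that assms(3) by auto
  have step: "word_eval G v (letter_mult G a u) = letter_eval G v a \<otimes>\<^bsub>G\<^esub> word_eval G v u"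
    if a: "letter_in G t a" and u: "\<forall>b\<in>set u. letter_in G t b" for a u
  proof (cases u)
    case Nil
    then show ?thesis using a by (cases a) (auto simp: word_eval_def)
  next
    case (Cons b u')
    have [simp]: "word_eval G v u' \<in> carrier G" using wcl u Cons by auto
    have e: "word_eval G v (c # s) = letter_eval G v c \<otimes>\<^bsub>G\<^esub> word_eval G v s" for c s
      by (simp add: word_eval_def)
    show ?thesis using a u Cons
      by (cases a; cases b) (auto simp: e vcl m_assoc[symmetric])
  qed
  have "(\<forall>a\<in>set (reduced_form G u). letter_in G t a)" if "\<forall>a\<in>set u. letter_in G t a" for u
    using reduced_form_in_and_reduced[OF assms(1) that] by blast
  then show ?thesis using assms(2)
    by (induction w) (use step in \<open>auto simp: reduced_form_def word_eval_def\<close>)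
qed

end

theory Submission
  imports Defs
begin

text \<open>If \<open>g q\<^sub>1 \<ge> q\<^sub>1\<close>, then the conjugate of \<open>h\<^sub>1\<close> by \<open>g\<close> fixes \<open>[q\<^sub>1, 1]\<close> pointwise, while \<open>h\<^sub>2\<close>
  fixes \<open>[0, q\<^sub>1]\<close> pointwise because \<open>q\<^sub>1 \<le> p\<^sub>2\<close>; hence the two commute and \<open>w\<^sup>-\<close> vanishes at \<open>g\<close>.
  Otherwise \<open>g\<^sup>-\<^sup>1 q\<^sub>1 \<ge> q\<^sub>1\<close> and \<open>w\<^sup>+\<close> vanishes at \<open>g\<close>. Either way the commutator of \<open>w\<^sup>-\<close> and \<open>w\<^sup>+\<close>
  vanishes at \<open>g\<close>. Spelled out as a word, that commutator is already reduced.\<close>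

section \<open>Piecewise linear maps with slopes powers of two\<close>

text \<open>Merges piecewise linearity, differentiability off the breaks and the slope condition
  into one clause free of derivatives. Only the interior of an interval has to miss
  \<open>S\<close>, so a piece includes its values at the breaks where it ends.\<close>

definition affine_off :: "real set \<Rightarrow> (real \<Rightarrow> real) \<Rightarrow> bool" where
  "affine_off S f \<longleftrightarrow>
     (\<forall>a b. 0 \<le> a \<and> a < b \<and> b \<le> 1 \<and> {a<..<b} \<inter> S = {} \<longrightarrow>
       (\<exists>(k::int) c. \<forall>x\<in>{a..b}. f x = 2 powi k * x + c))"

lemma affine_offE:
  assumes "affine_off S f" "0 \<le> a" "a < b" "b \<le> 1" "{a<..<b} \<inter> S = {}"
  obtains k :: int and c where "\<And>x. x \<in> {a..b} \<Longrightarrow> f x = 2 powi k * x + c"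
  using assms unfolding affine_off_def by blast

text \<open>A derivative within \<open>T\<close> restricts to \<open>{a..b}\<close>, where
  derivatives are unique even at an end point. Hence a one-sided affine piece at \<open>x\<close>
  already determines \<open>d\<close>.\<close>

lemma derivative_eq_slope:
  fixes f :: "real \<Rightarrow> real"
  assumes "a < b" "x \<in> {a..b}" "\<And>z. z \<in> {a..b} \<Longrightarrow> f z = m * z + c"
    and "(f has_real_derivative d) (at x within T)" "{a..b} \<subseteq> T"
  shows "d = m"
proof -
  have 1: "(f has_real_derivative d) (at x within {a..b})"
    using assms(4,5) by (rule DERIV_subset)
  have "((\<lambda>z. m * z + c) has_real_derivative m) (at x within {a..b})"
    by (auto intro!: derivative_eq_intros)
  then have 2: "(f has_real_derivative m) (at x within {a..b})"
    by (rule has_field_derivative_transform_within[where d=1]) (use assms(2,3) in auto)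
  have "at x within {a..b} \<noteq> bot"
    using \<open>a < b\<close> assms(2)
    by (cases "x = a"; cases "x = b")
      (auto simp: at_within_Icc_at_right at_within_Icc_at_left at_within_Icc_at)
  with 1 2 show ?thesis by (rule has_field_derivative_unique)
qed

text \<open>Induction on the number of breaks inside \<open>(a, b)\<close>. At a break
  \<open>s\<close> the pieces on both sides are affine by induction; the derivative at
  \<open>s\<close> equals both slopes, and the common value at \<open>s\<close> then equates the
  constants.\<close>

lemma affine_if_differentiable:
  fixes f :: "real \<Rightarrow> real"
  assumes "finite S"
    and pl: "\<forall>a b. l \<le> a \<and> a < b \<and> b \<le> r \<and> {a<..<b} \<inter> S = {} \<longrightarrow>
      (\<exists>m c. \<forall>x\<in>{a..b}. f x = m * x + c)"
    and "l \<le> a" "a < b" "b \<le> r"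
    and "\<And>x. x \<in> {a<..<b} \<Longrightarrow> f differentiable (at x within {l..r})"
  shows "\<exists>m c. \<forall>x\<in>{a..b}. f x = m * x + c"
  using assms(3-)
proof (induction "card (S \<inter> {a<..<b})" arbitrary: a b rule: less_induct)
  case less
  show ?case
  proof (cases "{a<..<b} \<inter> S = {}")
    case True
    then show ?thesis using pl less.prems by blast
  next
    case False
    then obtain s where s: "s \<in> S" "a < s" "s < b" by auto
    have fin: "finite (S \<inter> {a<..<b})" using \<open>finite S\<close> by blast
    have "card (S \<inter> {a<..<s}) < card (S \<inter> {a<..<b})"
      by (rule psubset_card_mono[OF fin]) (use s in auto)
    then obtain m c where mc: "\<And>x. x \<in> {a..s} \<Longrightarrow> f x = m * x + c"
      using less.hyps[of a s] less.prems s by fastforce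
    have "card (S \<inter> {s<..<b}) < card (S \<inter> {a<..<b})"
      by (rule psubset_card_mono[OF fin]) (use s in auto)
    then obtain m' c' where mc': "\<And>x. x \<in> {s..b} \<Longrightarrow> f x = m' * x + c'"
      using less.hyps[of s b] less.prems s by fastforce
    obtain d where d: "(f has_real_derivative d) (at s within {l..r})"
      using less.prems(4)[of s] s by (auto simp: real_differentiable_def)
    have "d = m" by (rule derivative_eq_slope[OF \<open>a < s\<close> _ mc d]) (use s less.prems in auto)
    moreover have "d = m'"
      by (rule derivative_eq_slope[OF \<open>s < b\<close> _ mc' d]) (use s less.prems in auto)
    ultimately have "m = m'" by simp
    moreover from this have "c = c'" using mc[of s] mc'[of s] s by auto
    ultimately have "f x = m * x + c" if "x \<in> {a..b}" for x
      using mc[of x] mc'[of x] that by (cases "x \<le> s") auto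
    then show ?thesis by blast
  qed
qed

lemma finite_gap_right:
  fixes x u :: real
  assumes "finite S" "x < u"
  obtains b where "x < b" "b \<le> u" "{x<..<b} \<inter> S = {}"
proof
  let ?b = "Min (insert u (S \<inter> {x<..<u}))"
  show "x < ?b" and b: "?b \<le> u" using assms by auto
  have "?b \<le> z" if "z \<in> S" "x < z" "z < u" for z
    using assms that by (intro Min_le) auto
  then show "{x<..<?b} \<inter> S = {}" using b by force
qed

text \<open>The nearest point of \<open>S\<close> to the left of \<open>x\<close>, or
  \<open>l\<close> if there is none. Knowing that \<open>a\<close> is such a point makes it dyadic
  when \<open>l\<close> and the points of \<open>S\<close> are.\<close>

lemma finite_gap_left:
  fixes x l :: real
  assumes "finite S" "l < x"
  obtains a where "l \<le> a" "a < x" "a \<in> insert l (S \<inter> {l<..<x})" "{a<..<x} \<inter> S = {}"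
proof
  let ?a = "Max (insert l (S \<inter> {l<..<x}))"
  show a: "l \<le> ?a" and "?a < x" using assms by auto
  show "?a \<in> insert l (S \<inter> {l<..<x})" using assms by (intro Max_in) auto
  have "z \<le> ?a" if "z \<in> S" "l < z" "z < x" for z
    using assms that by (intro Max_ge) auto
  then show "{?a<..<x} \<inter> S = {}" using a by force
qed

text \<open>One set of dyadic break points serves both piecewise linearity and differentiability: a break
  point at which the map is differentiable is superfluous. This form, unlike the definition, passes to
  compositions, whose derivative may exist at a point where those of the factors do not.\<close>

lemma thompson_maps_iff:
  "f \<in> thompson_maps \<longleftrightarrow> f \<in> extensional {0..1} \<and> strict_mono_on {0..1} f \<and>
     continuous_on {0..1} f \<and> f ` {0..1} = {0..1} \<and>
     (\<exists>S. finite S \<and> (\<forall>x\<in>S. dyadic x) \<and> affine_off S f)"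
  (is "_ \<longleftrightarrow> ?R")
proof
  assume f: "f \<in> thompson_maps"
  then have "piecewise_linear 0 1 f" by (simp add: thompson_maps_def)
  then obtain S0 where S0: "finite S0"
    "\<forall>a b. 0 \<le> a \<and> a < b \<and> b \<le> 1 \<and> {a<..<b} \<inter> S0 = {} \<longrightarrow>
      (\<exists>m c. \<forall>x\<in>{a..b}. f x = m * x + c)"
    unfolding piecewise_linear_def by (elim exE conjE)
  obtain S where S: "finite S" "\<forall>x\<in>S. dyadic x"
    "\<forall>x\<in>{0..1} - S. f differentiable (at x within {0..1})"
    using f unfolding thompson_maps_def by blast
  have pow: "\<exists>k::int. m = 2 powi k"
    if "x \<in> {0..1}" "(f has_real_derivative m) (at x within {0..1})" for x m
    using f that unfolding thompson_maps_def by blast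
  have "\<exists>(k::int) c. \<forall>x\<in>{a..b}. f x = 2 powi k * x + c"
    if ab: "0 \<le> a" "a < b" "b \<le> 1" "{a<..<b} \<inter> S = {}" for a b
  proof -
    have diff: "f differentiable (at x within {0..1})" if "x \<in> {a<..<b}" for x
    proof -
      have "x \<in> {0..1} - S" using ab that by auto
      with S(3) show ?thesis by blast
    qed
    obtain m c where mc: "\<forall>x\<in>{a..b}. f x = m * x + c"
      using affine_if_differentiable[OF S0 ab(1-3) diff] by blast
    \<comment> \<open>A sample interior point: \<open>f\<close> has a derivative there, which is the
      slope \<open>m\<close> and also a power of 2.\<close>
    let ?x = "(a + b) / 2"
    obtain d where d: "(f has_real_derivative d) (at ?x within {0..1})"
      using diff[of ?x] ab by (auto simp: real_differentiable_def)
    have "d = m"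
      by (rule derivative_eq_slope[OF \<open>a < b\<close> _ _ d]) (use ab mc in auto)
    with pow[OF _ d] ab obtain k :: int where "m = 2 powi k" by auto
    with mc show ?thesis by blast
  qed
  then have "affine_off S f" unfolding affine_off_def by blast
  with S f show ?R unfolding thompson_maps_def by blast
next
  assume R: ?R
  then obtain S where S: "finite S" "\<forall>x\<in>S. dyadic x" and aff: "affine_off S f" by blast
  have "piecewise_linear 0 1 f"
    unfolding piecewise_linear_def using S(1) aff unfolding affine_off_def by meson
  moreover have "f differentiable (at x within {0..1})" if x: "x \<in> {0..1} - S" for x
  proof -
    \<comment> \<open>Searching out to \<open>x - 1\<close> and \<open>x + 1\<close> leaves room on
      both sides even when \<open>x\<close> is 0 or 1; the gap is clipped to \<open>[0,1]\<close>
      afterwards.\<close>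
    obtain a where a: "x - 1 \<le> a" "a < x" "{a<..<x} \<inter> S = {}"
      using finite_gap_left[OF S(1), of "x - 1" x] by force
    obtain b where b: "b \<le> x + 1" "x < b" "{x<..<b} \<inter> S = {}"
      using finite_gap_right[OF S(1), of x "x + 1"] by force
    have "{a<..<b} \<subseteq> {a<..<x} \<union> {x} \<union> {x<..<b}" by auto
    then have "{a<..<b} \<inter> S = {}" using a b x by blast
    then have gap: "{max 0 a<..<min 1 b} \<inter> S = {}" by auto
    obtain k :: int and c where kc: "\<And>z. z \<in> {max 0 a..min 1 b} \<Longrightarrow> f z = 2 powi k * z + c"
      by (rule affine_offE[OF aff _ _ _ gap]) (use a b x in auto)
    have der: "((\<lambda>z. 2 powi k * z + c) has_real_derivative 2 powi k) (at x within {0..1})"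
      by (auto intro!: derivative_eq_intros)
    have "f z = 2 powi k * z + c"
      if "z \<in> {0..1}" "dist z x < min (x - a) (b - x)" for z
      using that by (intro kc) (auto simp: dist_real_def)
    then have "(f has_real_derivative 2 powi k) (at x within {0..1})"
      by (intro has_field_derivative_transform_within[OF der, where d="min (x - a) (b - x)"])
        (use a b x in auto)
    then show ?thesis by (auto simp: real_differentiable_def)
  qed
  moreover have "\<exists>k::int. m = 2 powi k"
    if x: "x \<in> {0..1}" and m: "(f has_real_derivative m) (at x within {0..1})" for x m
  proof -
    \<comment> \<open>Here \<open>x\<close> may be a break, so a piece on one side of it has to do:
      to the right of \<open>x\<close>, or to the left if \<open>x = 1\<close>.\<close>
    have "\<exists>a b. 0 \<le> a \<and> a < b \<and> b \<le> 1 \<and> x \<in> {a..b} \<and> {a<..<b} \<inter> S = {}"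
    proof (cases "x < 1")
      case True
      obtain b where "x < b" "b \<le> 1" "{x<..<b} \<inter> S = {}"
        using finite_gap_right[OF S(1) True] .
      then show ?thesis using x by (intro exI[of _ x] exI[of _ b]) auto
    next
      case False
      obtain a where "0 \<le> a" "a < 1" "{a<..<1} \<inter> S = {}"
        using finite_gap_left[OF S(1), of 0 1] by auto
      then show ?thesis using x False by (intro exI[of _ a] exI[of _ 1]) auto
    qed
    then obtain a b where ab: "0 \<le> a" "a < b" "b \<le> 1" "x \<in> {a..b}" "{a<..<b} \<inter> S = {}"
      by blast
    obtain k :: int and c where kc: "\<And>z. z \<in> {a..b} \<Longrightarrow> f z = 2 powi k * z + c"
      using affine_offE[OF aff ab(1-3,5)] by blast
    have "m = 2 powi k"
      by (rule derivative_eq_slope[OF ab(2,4) kc m]) (use ab in auto)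
    then show ?thesis by blast
  qed
  ultimately show "f \<in> thompson_maps"
    using R S unfolding thompson_maps_def by blast
qed

section \<open>Dyadic rationals and their images under maps with dyadic breaks\<close>

lemma dyadic_add: "dyadic x \<Longrightarrow> dyadic y \<Longrightarrow> dyadic (x + y)"
proof -
  assume "dyadic x" "dyadic y"
  then obtain k l :: int and m n :: nat where xy: "x = k / 2 ^ m" "y = l / 2 ^ n"
    unfolding dyadic_def by auto
  have "x + y = of_int (k * 2 ^ n + l * 2 ^ m) / 2 ^ (m + n)"
    unfolding xy by (simp add: field_simps power_add)
  then show ?thesis unfolding dyadic_def by blast
qed

lemma dyadic_mult: "dyadic x \<Longrightarrow> dyadic y \<Longrightarrow> dyadic (x * y)"
proof -
  assume "dyadic x" "dyadic y"
  then obtain k l :: int and m n :: nat where xy: "x = k / 2 ^ m" "y = l / 2 ^ n"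
    unfolding dyadic_def by auto
  have "x * y = of_int (k * l) / 2 ^ (m + n)"
    unfolding xy by (simp add: field_simps power_add)
  then show ?thesis unfolding dyadic_def by blast
qed

lemma dyadic_of_int: "dyadic (of_int k)"
  unfolding dyadic_def by (rule exI[of _ k], rule exI[of _ 0]) simp

lemma dyadic_powi: "dyadic (2 powi k)"
proof (cases "0 \<le> k")
  case True
  then show ?thesis using dyadic_of_int[of "2 ^ nat k"] by (simp add: power_int_def)
next
  case False
  then show ?thesis unfolding dyadic_def
    by (intro exI[of _ 1] exI[of _ "nat (- k)"]) (simp add: power_int_def divide_simps)
qed

lemma dyadic_powi_mult_iff: "dyadic (2 powi k * x) \<longleftrightarrow> dyadic x"
proof
  assume "dyadic (2 powi k * x)"
  then have "dyadic (2 powi (- k) * (2 powi k * x))" by (rule dyadic_mult[OF dyadic_powi])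
  then show "dyadic x" by (simp add: power_int_minus mult.assoc[symmetric])
qed (rule dyadic_mult[OF dyadic_powi])

lemma dyadic_add_iff: "dyadic s \<Longrightarrow> dyadic (s + x) \<longleftrightarrow> dyadic x"
  using dyadic_add[of s x] dyadic_add[of "s + x" "- s"] dyadic_mult[OF dyadic_of_int[of "-1"], of s]
  by auto

text \<open>Let \<open>s\<close> be the last break before \<open>x\<close>, or 0. Then
  \<open>f x = f s + 2 powi k * (x - s)\<close> with \<open>s\<close> and \<open>f s\<close> dyadic,
  the latter by induction on the number of breaks to the left. This is what keeps breaks dyadic
  under composition and inversion.\<close>

lemma affine_off_dyadic_iff:
  assumes "finite S" "\<And>x. x \<in> S \<Longrightarrow> dyadic x" "affine_off S f" "f 0 = 0" "x \<in> {0..1}"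
  shows "dyadic (f x) \<longleftrightarrow> dyadic x"
  using \<open>x \<in> {0..1}\<close>
proof (induction "card (S \<inter> {0<..<x})" arbitrary: x rule: less_induct)
  case less
  show ?case
  proof (cases "x = 0")
    case True
    then show ?thesis using \<open>f 0 = 0\<close> by simp
  next
    case False
    then have "0 < x" using less.prems by auto
    then obtain s where s: "0 \<le> s" "s < x" "s \<in> insert 0 (S \<inter> {0<..<x})" "{s<..<x} \<inter> S = {}"
      using finite_gap_left[OF assms(1), of 0 x] by metis
    have dyadic0: "dyadic 0" using dyadic_of_int[of 0] by simp
    have ds: "dyadic s" using s(3) assms(2) dyadic0 by auto
    have dfs: "dyadic (f s)"
    proof (cases "s = 0")
      case True
      then show ?thesis using \<open>f 0 = 0\<close> dyadic0 by simp
    next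
      case False
      \<comment> \<open>The count drops because \<open>s\<close> itself lies in
        \<open>(0, x)\<close> but not in \<open>(0, s)\<close>.\<close>
      have "card (S \<inter> {0<..<s}) < card (S \<inter> {0<..<x})"
        by (rule psubset_card_mono) (use assms(1) s False in auto)
      then show ?thesis using less.hyps[of s] ds s less.prems by auto
    qed
    obtain k :: int and c where kc: "\<And>z. z \<in> {s..x} \<Longrightarrow> f z = 2 powi k * z + c"
      using affine_offE[OF assms(3) s(1,2) _ s(4)] less.prems by auto
    have "f x = f s + 2 powi k * (x - s)"
      using kc[of s] kc[of x] s by (simp add: algebra_simps)
    then have "dyadic (f x) \<longleftrightarrow> dyadic (x - s)"
      by (simp add: dyadic_add_iff[OF dfs] dyadic_powi_mult_iff)
    also have "\<dots> \<longleftrightarrow> dyadic x"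
      using dyadic_add_iff[OF ds, of "x - s"] by simp
    finally show ?thesis .
  qed
qed


section \<open>The group structure\<close>

lemma thompson_maps_Bij:
  assumes "f \<in> thompson_maps"
  shows "f \<in> Bij {0..1}"
  using assms by (auto simp: thompson_maps_iff Bij_def bij_betw_def intro: strict_mono_on_imp_inj_on)

lemma thompson_maps_in:
  assumes "f \<in> thompson_maps" "x \<in> {0..1}"
  shows "f x \<in> {0..1}"
  using assms unfolding thompson_maps_iff by blast

lemma thompson_maps_less_iff:
  assumes "f \<in> thompson_maps" "x \<in> {0..1}" "y \<in> {0..1}"
  shows "f x < f y \<longleftrightarrow> x < y"
  using assms strict_mono_on_less[of "{0..1}" f] unfolding thompson_maps_iff by blast

lemma thompson_maps_le_iff:
  assumes "f \<in> thompson_maps" "x \<in> {0..1}" "y \<in> {0..1}"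
  shows "f x \<le> f y \<longleftrightarrow> x \<le> y"
  using thompson_maps_less_iff[OF assms(1,3,2)] by (simp add: not_less[symmetric])

lemma thompson_maps_0:
  assumes "f \<in> thompson_maps"
  shows "f 0 = 0"
proof -
  have "0 \<in> f ` {0..1}" using assms unfolding thompson_maps_iff by simp
  then obtain x where "x \<in> {0..1}" "f x = 0" by auto
  then show ?thesis
    using thompson_maps_le_iff[OF assms, of 0 x] thompson_maps_in[OF assms, of 0] by auto
qed

lemma thompson_mapsE:
  assumes "f \<in> thompson_maps"
  obtains S where "finite S" "affine_off S f" "\<forall>x\<in>S. dyadic x"
    "\<forall>x\<in>{0..1}. dyadic (f x) \<longleftrightarrow> dyadic x"
proof -
  obtain S where "finite S" "\<forall>x\<in>S. dyadic x" "affine_off S f"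
    using assms unfolding thompson_maps_iff by blast
  then show ?thesis
    using that affine_off_dyadic_iff[of S f] thompson_maps_0[OF assms] by blast
qed

section \<open>Identity, composition and inversion\<close>

lemma thompson_maps_id: "(\<lambda>x\<in>{0..1}. x) \<in> thompson_maps"
proof -
  have "continuous_on {0..1} (\<lambda>x\<in>{0..1::real}. x)"
    by (rule continuous_on_cong[THEN iffD2, OF refl _ continuous_on_id]) simp
  moreover have "affine_off {} (\<lambda>x\<in>{0..1}. x)"
    unfolding affine_off_def by (intro allI impI exI[of _ 0]) auto
  ultimately show ?thesis
    unfolding thompson_maps_iff
    by (intro conjI exI[of _ "{}"]) (auto simp: strict_mono_on_def)
qed

text \<open>A break of the composite is a break of \<open>g\<close> or a point that \<open>g\<close>
  sends to a break of \<open>f\<close>. The latter points are dyadic because \<open>g\<close>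
  reflects dyadicity, and finitely many because \<open>g\<close> is injective. Exponents of slopes
  add.\<close>

lemma thompson_maps_compose:
  assumes f: "f \<in> thompson_maps" and g: "g \<in> thompson_maps"
  shows "compose {0..1} f g \<in> thompson_maps"
proof -
  obtain S where S: "finite S" "affine_off S f" "\<forall>x\<in>S. dyadic x"
    using thompson_mapsE[OF f] by metis
  obtain T where T: "finite T" "affine_off T g" "\<forall>x\<in>T. dyadic x"
    "\<forall>x\<in>{0..1}. dyadic (g x) \<longleftrightarrow> dyadic x"
    using thompson_mapsE[OF g] by metis
  define U where "U = T \<union> {x \<in> {0..1}. g x \<in> S}"
  have inj: "inj_on g {0..1}" using g unfolding thompson_maps_iff
    by (auto intro: strict_mono_on_imp_inj_on)
  have "finite {x \<in> {0..1}. g x \<in> S}"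
    by (rule inj_on_finite[OF _ _ S(1), of g]) (use inj in \<open>auto intro: inj_on_subset\<close>)
  then have "finite U" unfolding U_def using T(1) by simp
  moreover have "\<forall>x\<in>U. dyadic x" unfolding U_def using S(3) T(3,4) by blast
  moreover have "\<exists>(k::int) c. \<forall>x\<in>{a..b}. compose {0..1} f g x = 2 powi k * x + c"
    if ab: "0 \<le> a" "a < b" "b \<le> 1" "{a<..<b} \<inter> U = {}" for a b
  proof -
    obtain k :: int and c where kc: "\<And>x. x \<in> {a..b} \<Longrightarrow> g x = 2 powi k * x + c"
      by (rule affine_offE[OF T(2) ab(1-3)]) (use ab(4) U_def in auto)
    have gab: "0 \<le> g a" "g a < g b" "g b \<le> 1"
      using thompson_maps_in[OF g, of a] thompson_maps_in[OF g, of b]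
        thompson_maps_less_iff[OF g, of a b] ab by auto
    \<comment> \<open>By surjectivity and monotonicity of \<open>g\<close>, a break of
      \<open>f\<close> in this interval would come from a point of \<open>U\<close> in
      \<open>(a, b)\<close>.\<close>
    have "{g a<..<g b} \<inter> S = {}"
    proof (rule ccontr)
      assume "{g a<..<g b} \<inter> S \<noteq> {}"
      then obtain y where y: "g a < y" "y < g b" "y \<in> S" by auto
      then have "y \<in> g ` {0..1}" using gab g unfolding thompson_maps_iff by auto
      then obtain x where x: "x \<in> {0..1}" "g x = y" by auto
      then have "a < x" "x < b"
        using y thompson_maps_less_iff[OF g] ab by auto
      with x y ab(4) show False unfolding U_def by auto
    qed
    then obtain l :: int and d where ld: "\<And>y. y \<in> {g a..g b} \<Longrightarrow> f y = 2 powi l * y + d"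
      using affine_offE[OF S(2) gab] by blast
    have "compose {0..1} f g x = 2 powi (l + k) * x + (2 powi l * c + d)" if "x \<in> {a..b}" for x
    proof -
      have "g x \<in> {g a..g b}"
        using thompson_maps_le_iff[OF g, of a x] thompson_maps_le_iff[OF g, of x b] that ab by auto
      then show ?thesis
        using that ab ld[of "g x"] kc[of x]
        by (simp add: compose_def power_int_add algebra_simps)
    qed
    then show ?thesis by blast
  qed
  moreover have "strict_mono_on {0..1} (compose {0..1} f g)"
    using thompson_maps_less_iff[OF f] thompson_maps_less_iff[OF g] thompson_maps_in[OF g]
    by (intro strict_mono_onI) (simp add: compose_def)
  moreover have "continuous_on {0..1} (f \<circ> g)"
    using f g by (intro continuous_on_compose) (simp_all add: thompson_maps_iff)
  then have "continuous_on {0..1} (compose {0..1} f g)"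
    by (rule continuous_on_cong[THEN iffD2, OF refl, rotated]) (simp add: compose_def)
  moreover have "compose {0..1} f g ` {0..1} = f ` g ` {0..1}"
    by (auto simp: compose_def image_image)
  then have "compose {0..1} f g ` {0..1} = {0..1}"
    using f g unfolding thompson_maps_iff by simp
  ultimately show ?thesis
    unfolding thompson_maps_iff affine_off_def by (auto intro!: exI[of _ U])
qed

text \<open>The restricted \<open>inv_into\<close> is the form that the inverse takes in
  \<open>BijGroup {0..1}\<close>. Its breaks are the images of those of \<open>f\<close>, and
  exponents of slopes change sign.\<close>

lemma thompson_maps_inv:
  assumes f: "f \<in> thompson_maps"
  shows "(\<lambda>x\<in>{0..1}. inv_into {0..1} f x) \<in> thompson_maps" (is "?g \<in> _")
proof -
  obtain S where S: "finite S" "affine_off S f" "\<forall>x\<in>S. dyadic x"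
    "\<forall>x\<in>{0..1}. dyadic (f x) \<longleftrightarrow> dyadic x"
    using thompson_mapsE[OF f] by metis
  have bij: "bij_betw f {0..1} {0..1}" using thompson_maps_Bij[OF f] unfolding Bij_def by blast
  have gf: "?g (f x) = x" if "x \<in> {0..1}" for x
    using bij that thompson_maps_in[OF f that] by (simp add: bij_betw_inv_into_left)
  have fg: "f (?g y) = y" if "y \<in> {0..1}" for y
    using bij that by (simp add: bij_betw_inv_into_right)
  have g_in: "?g y \<in> {0..1}" if "y \<in> {0..1}" for y
    using bij_betw_inv_into[OF bij] that by (auto simp: bij_betw_def)
  have mono: "?g x < ?g y \<longleftrightarrow> x < y" if "x \<in> {0..1}" "y \<in> {0..1}" for x y
    using thompson_maps_less_iff[OF f g_in[OF that(1)] g_in[OF that(2)]]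
    unfolding fg[OF that(1)] fg[OF that(2)] by simp
  \<comment> \<open>\<open>S\<close> may contain points outside \<open>[0,1]\<close>, where
    \<open>f\<close> is \<open>undefined\<close> and its values need not be dyadic.\<close>
  let ?T = "f ` (S \<inter> {0..1})"
  have "\<exists>(k::int) c. \<forall>y\<in>{a..b}. ?g y = 2 powi k * y + c"
    if ab: "0 \<le> a" "a < b" "b \<le> 1" "{a<..<b} \<inter> ?T = {}" for a b
  proof -
    have ab': "a \<in> {0..1}" "b \<in> {0..1}" using ab by auto
    have gab: "0 \<le> ?g a" "?g a < ?g b" "?g b \<le> 1"
      using g_in[OF ab'(1)] g_in[OF ab'(2)] mono[OF ab'] \<open>a < b\<close> by (simp_all del: restrict_apply)
    have "{?g a<..<?g b} \<inter> S = {}"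
    proof (rule ccontr)
      assume "{?g a<..<?g b} \<inter> S \<noteq> {}"
      then obtain x where x: "?g a < x" "x < ?g b" "x \<in> S" by auto
      then have x01: "x \<in> {0..1}" using gab by (simp del: restrict_apply)
      have "f (?g a) < f x" "f x < f (?g b)"
        using x x01 g_in[OF ab'(1)] g_in[OF ab'(2)] thompson_maps_less_iff[OF f] by blast+
      then have "a < f x" "f x < b" unfolding fg[OF ab'(1)] fg[OF ab'(2)] .
      with x x01 ab(4) show False by auto
    qed
    then obtain k :: int and c where kc: "\<And>x. x \<in> {?g a..?g b} \<Longrightarrow> f x = 2 powi k * x + c"
      using affine_offE[OF S(2) gab] by blast
    have "?g y = 2 powi (- k) * y + (- (2 powi (- k) * c))" if "y \<in> {a..b}" for y
    proof -
      have y: "y \<in> {0..1}" using that ab by auto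
      have "\<not> ?g y < ?g a" "\<not> ?g b < ?g y"
        unfolding mono[OF y ab'(1)] mono[OF ab'(2) y] using that by auto
      then have "y = 2 powi k * ?g y + c"
        using kc[of "?g y"] unfolding fg[OF y] by (simp add: not_less del: restrict_apply)
      then have "2 powi (- k) * (y - c) = ?g y"
        by (simp add: power_int_minus field_simps del: restrict_apply)
      then show ?thesis by (simp add: algebra_simps del: restrict_apply)
    qed
    then show ?thesis by blast
  qed
  then have "affine_off ?T ?g" unfolding affine_off_def by blast
  moreover have "finite ?T" "\<forall>y\<in>?T. dyadic y" using S by auto
  moreover have "strict_mono_on {0..1} ?g" using mono by (blast intro: strict_mono_onI)
  \<comment> \<open>A continuous injection on a compact set has a continuous inverse.\<close>
  moreover have "continuous_on (f ` {0..1}) ?g"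
    by (rule continuous_on_inv) (use f gf in \<open>auto simp: thompson_maps_iff\<close>)
  then have "continuous_on {0..1} ?g" using f unfolding thompson_maps_iff by simp
  moreover have "?g ` {0..1} = {0..1}"
  proof
    show "?g ` {0..1} \<subseteq> {0..1}" using g_in by blast
    show "{0..1} \<subseteq> ?g ` {0..1}"
      using gf thompson_maps_in[OF f] by (metis image_eqI subsetI)
  qed
  ultimately show ?thesis unfolding thompson_maps_iff by blast
qed

lemma carrier_thompson_F: "carrier thompson_F = thompson_maps"
  by (simp add: thompson_F_def)

lemma subgroup_thompson_maps: "subgroup thompson_maps (BijGroup {0..1})"
proof -
  interpret group "BijGroup {0..1::real}" by (rule group_BijGroup)
  show ?thesis
  proof (rule subgroupI)
    show "thompson_maps \<subseteq> carrier (BijGroup {0..1})"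
      using thompson_maps_Bij by (auto simp: BijGroup_def)
    show "thompson_maps \<noteq> {}" using thompson_maps_id by blast
    show "inv\<^bsub>BijGroup {0..1}\<^esub> f \<in> thompson_maps" if "f \<in> thompson_maps" for f
      using that by (simp add: inv_BijGroup thompson_maps_Bij thompson_maps_inv)
    show "f \<otimes>\<^bsub>BijGroup {0..1}\<^esub> g \<in> thompson_maps"
      if "f \<in> thompson_maps" "g \<in> thompson_maps" for f g
      using that by (simp add: BijGroup_def thompson_maps_Bij thompson_maps_compose)
  qed
qed

lemma group_thompson_F: "group thompson_F"
  unfolding thompson_F_def
  using subgroup.subgroup_is_group[OF subgroup_thompson_maps group_BijGroup] .

lemma mult_thompson_F:
  assumes "f \<in> carrier thompson_F" "g \<in> carrier thompson_F" "x \<in> {0..1}"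
  shows "(f \<otimes>\<^bsub>thompson_F\<^esub> g) x = f (g x)"
  using assms by (simp add: thompson_F_def BijGroup_def thompson_maps_Bij compose_def)

lemma one_thompson_F: "x \<in> {0..1} \<Longrightarrow> \<one>\<^bsub>thompson_F\<^esub> x = x"
  by (simp add: thompson_F_def BijGroup_def)

lemma inv_thompson_F_apply:
  assumes f: "f \<in> carrier thompson_F" and x: "x \<in> {0..1}"
  shows "(inv\<^bsub>thompson_F\<^esub> f) (f x) = x"
proof -
  interpret group thompson_F by (rule group_thompson_F)
  show ?thesis
    using mult_thompson_F[OF inv_closed[OF f] f x] f x by (simp add: one_thompson_F)
qed

lemma thompson_F_eqI:
  assumes "f \<in> carrier thompson_F" "g \<in> carrier thompson_F" "\<And>x. x \<in> {0..1} \<Longrightarrow> f x = g x"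
  shows "f = g"
  using assms unfolding carrier_thompson_F thompson_maps_iff by (blast intro: extensionalityI)

section \<open>Supports and commuting elements\<close>

text \<open>The definition leaves the end points \<open>p\<close> and \<open>q\<close> open. If
  \<open>f\<close> moves \<open>x\<close>, it also moves \<open>f x\<close> and the preimage
  \<open>z\<close> of \<open>x\<close>, so both lie in \<open>[p, q]\<close>; as \<open>x\<close> is
  strictly between them, \<open>p < x < q\<close>.\<close>

lemma thompson_F_on_fixes:
  assumes f: "f \<in> thompson_F_on p q" and x: "x \<in> {0..1}" and "x \<le> p \<or> q \<le> x"
  shows "f x = x"
proof (rule ccontr)
  assume ne: "f x \<noteq> x"
  have F: "f \<in> thompson_maps" and fixed: "\<And>z. z \<in> {0..1} \<Longrightarrow> z < p \<or> q < z \<Longrightarrow> f z = z"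
    using f unfolding thompson_F_on_def carrier_thompson_F by auto
  have "x \<in> f ` {0..1}" using F x unfolding thompson_maps_iff by simp
  then obtain z where z: "z \<in> {0..1}" "f z = x" by auto
  have mono: "z < x \<longleftrightarrow> x < f x" "x < z \<longleftrightarrow> f x < x"
    using thompson_maps_less_iff[OF F] x z by metis+
  have "f (f x) \<noteq> f x" using thompson_maps_less_iff[OF F] x ne thompson_maps_in[OF F x]
    by (metis linorder_neqE_linordered_idom order_less_irrefl)
  then have "\<not> (f x < p \<or> q < f x)" using fixed thompson_maps_in[OF F x] by blast
  moreover have "f z \<noteq> z" using z ne by auto
  then have "\<not> (z < p \<or> q < z)" using fixed z by blast
  ultimately show False using mono assms(3) ne by linarith
qed

text \<open>Both maps fix \<open>q\<close>, so by monotonicity each preserves \<open>[0, q]\<close>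
  and \<open>[q, 1]\<close>; on either half one of them is the identity.\<close>

lemma thompson_F_commute:
  assumes "f \<in> carrier thompson_F" "g \<in> carrier thompson_F" "q \<in> {0..1}"
    and f: "\<And>x. x \<in> {0..1} \<Longrightarrow> q \<le> x \<Longrightarrow> f x = x"
    and g: "\<And>x. x \<in> {0..1} \<Longrightarrow> x \<le> q \<Longrightarrow> g x = x"
  shows "f \<otimes>\<^bsub>thompson_F\<^esub> g = g \<otimes>\<^bsub>thompson_F\<^esub> f"
proof -
  interpret group thompson_F by (rule group_thompson_F)
  note F = assms(1)[unfolded carrier_thompson_F] and G = assms(2)[unfolded carrier_thompson_F]
  have "f (g x) = g (f x)" if x: "x \<in> {0..1}" for x
  proof (cases "x \<le> q")
    case True
    then have "f x \<le> q"
      using thompson_maps_le_iff[OF F x \<open>q \<in> {0..1}\<close>] f[of q] \<open>q \<in> {0..1}\<close> by simp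
    then show ?thesis using g[OF thompson_maps_in[OF F x]] g[OF x True] by simp
  next
    case False
    then have "q \<le> g x"
      using thompson_maps_le_iff[OF G \<open>q \<in> {0..1}\<close> x] g[of q] \<open>q \<in> {0..1}\<close> by simp
    then show ?thesis using f[OF thompson_maps_in[OF G x]] f[OF x] False by simp
  qed
  then show ?thesis
    using assms(1,2) by (intro thompson_F_eqI) (auto simp: mult_thompson_F)
qed

text \<open>Stated for any \<open>u\<close> so that it serves twice: with the value of the variable
  for \<open>wminus\<close>, with the inverse of that value for \<open>wplus\<close>. Since
  \<open>u\<close> maps \<open>[q1, 1]\<close> into itself, \<open>h1\<close> acts trivially on the
  image.\<close>

lemma conjugate_commute:
  assumes h1: "h1 \<in> thompson_F_on p1 q1" and h2: "h2 \<in> thompson_F_on p2 q2"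
    and q1: "q1 \<in> {0..1}" "q1 \<le> p2" and u: "u \<in> carrier thompson_F" "q1 \<le> u q1"
  shows "(inv\<^bsub>thompson_F\<^esub> u \<otimes>\<^bsub>thompson_F\<^esub> h1 \<otimes>\<^bsub>thompson_F\<^esub> u) \<otimes>\<^bsub>thompson_F\<^esub> h2 =
    h2 \<otimes>\<^bsub>thompson_F\<^esub> (inv\<^bsub>thompson_F\<^esub> u \<otimes>\<^bsub>thompson_F\<^esub> h1 \<otimes>\<^bsub>thompson_F\<^esub> u)"
proof -
  interpret group thompson_F by (rule group_thompson_F)
  have hc: "h1 \<in> carrier thompson_F" "h2 \<in> carrier thompson_F"
    using h1 h2 unfolding thompson_F_on_def by auto
  note U = u(1)[unfolded carrier_thompson_F]
  show ?thesis
  proof (rule thompson_F_commute[OF _ hc(2) q1(1)])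
    fix x :: real assume x: "x \<in> {0..1}" "q1 \<le> x"
    then have "q1 \<le> u x" using thompson_maps_le_iff[OF U q1(1) x(1)] u(2) by simp
    then have "h1 (u x) = u x" using thompson_F_on_fixes[OF h1] thompson_maps_in[OF U x(1)] by blast
    then show "(inv\<^bsub>thompson_F\<^esub> u \<otimes>\<^bsub>thompson_F\<^esub> h1 \<otimes>\<^bsub>thompson_F\<^esub> u) x = x"
      using u(1) hc x thompson_maps_in[OF U x(1)] by (simp add: mult_thompson_F inv_thompson_F_apply)
  next
    fix x :: real assume "x \<in> {0..1}" "x \<le> q1"
    then show "h2 x = x" using thompson_F_on_fixes[OF h2] q1(2) by simp
  qed (use u hc in auto)
qed

section \<open>Evaluation of words\<close>

context group
begin

context
  fixes v :: "nat \<Rightarrow> 'a" and t :: nat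
  assumes v: "v \<in> {..<t} \<rightarrow> carrier G"
begin

lemma letter_eval_closed: "letter_in G t a \<Longrightarrow> letter_eval G v a \<in> carrier G"
  using v by (cases a) auto

lemma word_eval_closed: "\<forall>a\<in>set w. letter_in G t a \<Longrightarrow> word_eval G v w \<in> carrier G"
  by (induction w) (auto simp: word_eval_def letter_eval_closed)

lemma word_eval_append:
  assumes "\<forall>a\<in>set w. letter_in G t a" "\<forall>a\<in>set u. letter_in G t a"
  shows "word_eval G v (w @ u) = word_eval G v w \<otimes> word_eval G v u"
  using assms(1) word_eval_closed word_eval_closed[OF assms(2)]
  by (induction w) (auto simp: word_eval_def letter_eval_closed m_assoc)

text \<open>Reversal of the letters mirrors the reversal in the inverse of a product. The second
  fact lets inverse words enter further concatenations.\<close>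

lemma word_eval_word_inv:
  assumes "\<forall>a\<in>set w. letter_in G t a"
  shows "word_eval G v (word_inv G w) = inv (word_eval G v w)"
    and "\<forall>a\<in>set (word_inv G w). letter_in G t a"
proof -
  have li: "letter_in G t (letter_inv G a)" if "letter_in G t a" for a
    using that by (cases a) auto
  show in_inv: "\<forall>a\<in>set (word_inv G w). letter_in G t a"
    using assms li unfolding word_inv_def by auto
  have le: "letter_eval G v (letter_inv G a) = inv (letter_eval G v a)" if "letter_in G t a" for a
    using that v by (cases a) (auto dest: funcset_mem)
  show "word_eval G v (word_inv G w) = inv (word_eval G v w)"
    using assms
  proof (induction w)
    case (Cons a w)
    have "word_inv G (a # w) = word_inv G w @ [letter_inv G a]" by (simp add: word_inv_def)
    moreover have "word_eval G v (word_inv G w @ [letter_inv G a]) =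
        word_eval G v (word_inv G w) \<otimes> word_eval G v [letter_inv G a]"
      by (rule word_eval_append) (use Cons.prems li in \<open>auto simp: word_inv_def\<close>)
    moreover have "word_eval G v [letter_inv G a] = inv (letter_eval G v a)"
      using Cons.prems by (simp add: word_eval_def le letter_eval_closed)
    ultimately show ?case
      using Cons word_eval_closed[of w] letter_eval_closed[of a]
      by (simp add: word_eval_def inv_mult_group)
  qed (simp add: word_inv_def word_eval_def)
qed

lemma word_eval_conj:
  assumes "\<forall>a\<in>set w. letter_in G t a" "\<forall>a\<in>set u. letter_in G t a"
  shows "word_eval G v (word_conj G w u) =
      inv (word_eval G v u) \<otimes> word_eval G v w \<otimes> word_eval G v u"
  using assms word_eval_word_inv[OF assms(2)] word_eval_closed[OF assms(1)] word_eval_closed[OF assms(2)]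
  by (auto simp: word_conj_def word_eval_append m_assoc ball_Un)

text \<open>Serves both levels of the nested commutator: inside, a conjugate of \<open>h1\<close>
  commutes with \<open>h2\<close>; outside, one of the two entries has value 1.\<close>

lemma word_eval_comm_eq_one:
  assumes "\<forall>a\<in>set w. letter_in G t a" "\<forall>a\<in>set u. letter_in G t a"
    and "word_eval G v w \<otimes> word_eval G v u = word_eval G v u \<otimes> word_eval G v w"
  shows "word_eval G v (word_comm G w u) = \<one>"
proof -
  note wi = word_eval_word_inv[OF assms(1)] and ui = word_eval_word_inv[OF assms(2)]
  have cl: "word_eval G v w \<in> carrier G" "word_eval G v u \<in> carrier G"
    using assms word_eval_closed by auto
  have "word_eval G v (word_comm G w u) =
      inv (word_eval G v w) \<otimes> (inv (word_eval G v u) \<otimes> (word_eval G v w \<otimes> word_eval G v u))"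
    using assms(1,2) wi ui by (simp add: word_comm_def word_eval_append ball_Un)
  also have "\<dots> = \<one>"
    unfolding assms(3) using cl by (simp add: m_assoc[symmetric])
  finally show ?thesis .
qed

lemma word_in_comm:
  assumes "\<forall>a\<in>set w. letter_in G t a" "\<forall>a\<in>set u. letter_in G t a"
  shows "\<forall>a\<in>set (word_comm G w u). letter_in G t a"
  using assms word_eval_word_inv(2)[OF assms(1)] word_eval_word_inv(2)[OF assms(2)]
  by (auto simp: word_comm_def)

end

end

section \<open>The nested commutator as a law\<close>

theorem proposition4p3:
  fixes p1 q1 p2 q2 :: real and h1 h2 :: "real \<Rightarrow> real"
  assumes "dyadic p1" "dyadic q1" "0 \<le> p1" "p1 < q1" "q1 \<le> 1"
    and "dyadic p2" "dyadic q2" "0 \<le> p2" "p2 < q2" "q2 \<le> 1"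
    and "{p1<..<q1} \<inter> {p2<..<q2} = {}"
    and "p1 < p2"
    and "h1 \<in> thompson_F_on p1 q1" "h1 \<noteq> \<one>\<^bsub>thompson_F\<^esub>"
    and "h2 \<in> thompson_F_on p2 q2" "h2 \<noteq> \<one>\<^bsub>thompson_F\<^esub>"
  shows "let F = thompson_F;
             y = [Var 0];
             wminus = word_comm F (word_conj F [Const h1] y) [Const h2];
             wplus = word_comm F (word_conj F [Const h1] (word_inv F y)) [Const h2]
         in law_with_constants F 1 (reduced_form F (word_comm F wminus wplus))"
proof -
  interpret group thompson_F by (rule group_thompson_F)
  let ?F = thompson_F and ?y = "[Var 0]"
  let ?A = "word_conj ?F [Const h1] ?y" and ?B = "word_conj ?F [Const h1] (word_inv ?F ?y)"
  let ?wm = "word_comm ?F ?A [Const h2]" and ?wp = "word_comm ?F ?B [Const h2]"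
  let ?w = "word_comm ?F ?wm ?wp"
  have h: "h1 \<in> carrier ?F" "h2 \<in> carrier ?F"
    using assms unfolding thompson_F_on_def by auto
  \<comment> \<open>A reduced word must not contain the constant 1, and inverses of
    \<open>h1\<close> and \<open>h2\<close> occur as letters.\<close>
  have inv_ne: "\<one>\<^bsub>?F\<^esub> \<noteq> inv\<^bsub>?F\<^esub> h1" "\<one>\<^bsub>?F\<^esub> \<noteq> inv\<^bsub>?F\<^esub> h2"
    using h assms(14,16) by (metis inv_inv inv_one)+
  note unfold_word = word_comm_def word_conj_def word_inv_def
  \<comment> \<open>Constants and variables alternate except where the inverse of \<open>?wp\<close>
    meets \<open>?wm\<close>; there the adjacent letters are both \<open>VarInv 0\<close>, which do
    not cancel.\<close>
  have red: "reduced_word ?F ?w"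
    using assms(14,16) inv_ne h by (simp add: unfold_word reduced_word_def)
  have letters: "\<forall>a\<in>set ?w. letter_in ?F 1 a"
    using h by (simp add: unfold_word)
  have "q1 \<le> p2"
  proof (rule ccontr)
    assume "\<not> q1 \<le> p2"
    \<comment> \<open>As \<open>p1 < p2\<close>, the overlap would be
      \<open>(p2, min q1 q2)\<close>; its midpoint is the witness.\<close>
    then have "(p2 + min q1 q2) / 2 \<in> {p1<..<q1} \<inter> {p2<..<q2}" using assms by auto
    with assms(11) show False by blast
  qed
  have q1: "q1 \<in> {0..1}" using assms by auto
  have "word_eval ?F v ?w = \<one>\<^bsub>?F\<^esub>" if v: "v \<in> {..<1} \<rightarrow> carrier ?F" for v
  proof -
    let ?g = "v 0"
    have g: "?g \<in> carrier ?F" using v by auto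
    have A: "word_eval ?F v ?A = inv\<^bsub>?F\<^esub> ?g \<otimes>\<^bsub>?F\<^esub> h1 \<otimes>\<^bsub>?F\<^esub> ?g"
      using word_eval_conj[OF v, of "[Const h1]" ?y] g h by (simp add: word_eval_def)
    \<comment> \<open>The double inverse is kept so that the value has the shape of
      \<open>conjugate_commute\<close> with \<open>u\<close> the inverse of
      \<open>?g\<close>.\<close>
    have B: "word_eval ?F v ?B = inv\<^bsub>?F\<^esub> (inv\<^bsub>?F\<^esub> ?g) \<otimes>\<^bsub>?F\<^esub> h1 \<otimes>\<^bsub>?F\<^esub> inv\<^bsub>?F\<^esub> ?g"
      using word_eval_conj[OF v, of "[Const h1]" "word_inv ?F ?y"] g h
      by (simp add: word_eval_def word_inv_def)
    have C: "word_eval ?F v [Const h2] = h2" using h by (simp add: word_eval_def)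
    have lA: "\<forall>a\<in>set ?A. letter_in ?F 1 a" and lB: "\<forall>a\<in>set ?B. letter_in ?F 1 a"
      and lC: "\<forall>a\<in>set [Const h2]. letter_in ?F 1 a"
      using h by (simp_all add: unfold_word)
    note lm = word_in_comm[OF v lA lC] and lp = word_in_comm[OF v lB lC]
    have cl: "word_eval ?F v ?wm \<in> carrier ?F" "word_eval ?F v ?wp \<in> carrier ?F"
      using word_eval_closed[OF v] lm lp by blast+
    have "word_eval ?F v ?wm = \<one>\<^bsub>?F\<^esub> \<or> word_eval ?F v ?wp = \<one>\<^bsub>?F\<^esub>"
    proof (cases "q1 \<le> ?g q1")
      case True
      have "word_eval ?F v ?wm = \<one>\<^bsub>?F\<^esub>"
        by (rule word_eval_comm_eq_one[OF v lA lC], unfold A C)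
          (rule conjugate_commute[OF assms(13,15) q1 \<open>q1 \<le> p2\<close> g True])
      then show ?thesis ..
    next
      case False
      have gi: "inv\<^bsub>?F\<^esub> ?g \<in> carrier ?F" using g by simp
      have gq: "?g q1 \<in> {0..1}" using thompson_maps_in g q1 unfolding carrier_thompson_F by blast
      \<comment> \<open>Applying the increasing inverse to \<open>?g q1 < q1\<close> moves the
        inequality to the inverse.\<close>
      have "(inv\<^bsub>?F\<^esub> ?g) (?g q1) \<le> (inv\<^bsub>?F\<^esub> ?g) q1"
        using thompson_maps_le_iff[OF gi[unfolded carrier_thompson_F] gq q1] False by simp
      then have "q1 \<le> (inv\<^bsub>?F\<^esub> ?g) q1" by (simp only: inv_thompson_F_apply[OF g q1])
      then have "word_eval ?F v ?wp = \<one>\<^bsub>?F\<^esub>"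
        by (intro word_eval_comm_eq_one[OF v lB lC], unfold B C)
          (rule conjugate_commute[OF assms(13,15) q1 \<open>q1 \<le> p2\<close> gi])
      then show ?thesis ..
    qed
    then show ?thesis
      using word_eval_comm_eq_one[OF v lm lp] cl by auto
  qed
  moreover have "?w \<noteq> []" "Var 0 \<in> set ?w" "Const h1 \<in> set ?w"
    using h by (simp_all add: unfold_word)
  ultimately have "law_with_constants ?F 1 ?w"
    unfolding law_with_constants_def using letters red by blast
  then show ?thesis by (simp add: Let_def reduced_form_id[OF red])
qed

end
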